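(* Let $A$ be an $m\times m$ nonsingular real matrix, let $z\in\mathbb{R}^m$, and let $K=A\mathbb{R}^m_+$. Let $\{x_k\}$ be a semi-smooth Newton sequence in $\mathbb{R}^m$, i.e. $$\left(\left(A^\top A-I\right)\operatorname{diag}(\operatorname{sgn}(x_k^+))+I\right)x_{k+1}=A^\top z,\qquad k=0,1,2,\ldots.$$ If for some $k$ it happens that $\operatorname{sgn}(x_{k+1}^+)=\operatorname{sgn}(x_k^+)$, then $x_{k+1}$ solves the equation $$\left(A^\top A-I\right)x^++x=A^\top z,$$ and $P_K(z)=Ax_{k+1}^+$.
   Context: $\mathbb{R}^m$ carries the canonical scalar product and the Euclidean norm $\|\cdot\|$. $I$ is the $m\times m$ identity matrix. For $x=(x^1,\dots,x^m)\in\mathbb{R}^m$, $x^+=(\max\{x^1,0\},\dots,\max\{x^m,0\})$; $\operatorname{sgn}(x)$ is the vector whose components are $1$, $0$ or $-1$ according to whether the corresponding component of $x$ is positive, zero or negative; $\operatorname{diag}(x)$ is the diagonal matrix with diagonal entries the components of $x$. $\mathbb{R}^m_+$ is the nonnegative orthant, $K=A\mathbb{R}^m_+=\{Ay:y\in\mathbb{R}^m_+\}$ is the simplicial cone associated with $A$, and $P_K(z)=\operatorname{argmin}\{\|z-y\|:y\in K\}$ is the metric projection of $z$ onto $K$. *)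

theory Defs
  imports "HOL-Analysis.Analysis"
begin

definition pos_part :: "real ^ 'm \<Rightarrow> real ^ 'm" where
  "pos_part x = (\<chi> i. max (x $ i) 0)"

(* Not the library's sgn on real ^ 'm, which is the normalisation x /\<^sub>R norm x. *)
definition sgn_vec :: "real ^ 'm \<Rightarrow> real ^ 'm" where
  "sgn_vec x = (\<chi> i. sgn (x $ i))"

definition diag :: "real ^ 'm \<Rightarrow> real ^ 'm ^ 'm" where
  "diag x = (\<chi> i j. if i = j then x $ i else 0)"

definition nonneg_orthant :: "(real ^ 'm) set" where
  "nonneg_orthant = {y. \<forall>i. 0 \<le> y $ i}"

definition simplicial_cone :: "real ^ 'm ^ 'm \<Rightarrow> (real ^ 'm) set" where
  "simplicial_cone A = (\<lambda>y. A *v y) ` nonneg_orthant"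

definition newton_sequence ::
  "real ^ 'm ^ 'm \<Rightarrow> real ^ 'm \<Rightarrow> (nat \<Rightarrow> real ^ 'm) \<Rightarrow> bool" where
  "newton_sequence A z x \<longleftrightarrow>
     (\<forall>k. ((transpose A ** A - mat 1) ** diag (sgn_vec (pos_part (x k))) + mat 1) *v x (Suc k)
            = transpose A *v z)"

(* The metric projection onto K is the library's closest_point K; simplicial cones of
   invertible matrices are nonempty, closed and convex, so the minimiser it chooses
   exists and is unique. *)

end

theory Submission
  imports Defs
begin

(* At a repeated sign pattern the diagonal factor maps x (Suc k) to its positive part, so the
   Newton step becomes the piecewise linear equation. That equation says
   A^T (z - A x^+) = x - x^+, whose right-hand side is nonpositive and orthogonal to x^+: this is
   the obtuse angle characterisation of A x^+ as the projection of z onto the cone. *)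

lemma closed_nonneg_orthant: "closed (nonneg_orthant :: (real ^ 'm) set)"
  unfolding nonneg_orthant_def by (intro closed_Collect_all closed_Collect_le continuous_intros)

lemma convex_nonneg_orthant: "convex (nonneg_orthant :: (real ^ 'm) set)"
  unfolding nonneg_orthant_def convex_def by auto

lemma convex_simplicial_cone: "convex (simplicial_cone A)"
  unfolding simplicial_cone_def
  by (intro convex_linear_image matrix_vector_mul_linear convex_nonneg_orthant)

text \<open>Linear images of closed sets need not be closed; invertibility of \<open>A\<close> gives
  the injectivity that preserves closedness here.\<close>

lemma closed_simplicial_cone:
  assumes "invertible A"
  shows "closed (simplicial_cone A)"
  unfolding simplicial_cone_def
  using assms
  by (intro closed_injective_linear_image closed_nonneg_orthant matrix_vector_mul_linear)
     (simp add: inj_matrix_vector_mult)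

lemma pos_part_in_nonneg_orthant: "pos_part x \<in> nonneg_orthant"
  by (simp add: pos_part_def nonneg_orthant_def)

lemma diag_mult_vec: "diag d *v x = (\<chi> i. d $ i * x $ i)"
  by (simp add: diag_def matrix_vector_mult_def vec_eq_iff if_distrib[where f = "\<lambda>t. t * _"]
      cong: if_cong)

text \<open>The signs of \<open>pos_part x\<close> are 0 or 1, so the diagonal matrix is the
  coordinate projection that keeps exactly the positive entries of \<open>x\<close>.\<close>

lemma diag_sgn_pos_part: "diag (sgn_vec (pos_part x)) *v x = pos_part x"
proof -
  have "sgn (max t 0) * t = max t 0" for t :: real
    by (cases "t \<le> 0") auto
  then show ?thesis
    by (simp add: diag_mult_vec sgn_vec_def pos_part_def)
qed

text \<open>Each summand is nonpositive: if \<open>x $ i\<close> \<le> 0 it equals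
  \<open>x $ i * y $ i\<close>, otherwise its first factor vanishes. Geometrically,
  \<open>pos_part x\<close> is the projection of \<open>x\<close> onto the orthant.\<close>

lemma inner_diff_pos_part_le:
  assumes "y \<in> nonneg_orthant"
  shows "(x - pos_part x) \<bullet> (y - pos_part x) \<le> 0"
  unfolding inner_vec_def
proof (rule sum_nonpos)
  fix i
  have "0 \<le> y $ i"
    using assms by (simp add: nonneg_orthant_def)
  then show "(x - pos_part x) $ i \<bullet> (y - pos_part x) $ i \<le> 0"
    by (cases "x $ i \<le> 0") (auto simp: pos_part_def mult_nonpos_nonneg)
qed

lemma closest_point_eqI:
  fixes p :: "'a :: euclidean_space"
  assumes "convex S" "closed S" "p \<in> S"
    and obtuse: "\<And>w. w \<in> S \<Longrightarrow> (z - p) \<bullet> (w - p) \<le> 0"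
  shows "closest_point S z = p"
proof (rule closest_point_unique[symmetric, OF assms(1-3)], intro ballI)
  fix w assume "w \<in> S"
  \<comment> \<open>Expand the square of \<open>z - w = (z - p) - (w - p)\<close>; by obtuseness the
    cross term can only increase the distance.\<close>
  have "(norm (z - w))\<^sup>2 = (norm (z - p))\<^sup>2 - 2 * ((z - p) \<bullet> (w - p)) + (norm (w - p))\<^sup>2"
    by (simp add: power2_norm_eq_inner inner_diff_left inner_diff_right inner_commute)
  then have "(norm (z - p))\<^sup>2 \<le> (norm (z - w))\<^sup>2"
    using obtuse[OF \<open>w \<in> S\<close>] zero_le_power2[of "norm (w - p)"] by linarith
  then show "dist z p \<le> dist z w"
    unfolding dist_norm by (rule power2_le_imp_le) simp
qed

lemma closest_point_simplicial_cone:
  assumes "invertible A"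
    and eq: "(transpose A ** A - mat 1) *v pos_part x + x = transpose A *v z"
  shows "closest_point (simplicial_cone A) z = A *v pos_part x"
proof (rule closest_point_eqI)
  show "convex (simplicial_cone A)" "closed (simplicial_cone A)"
    by (simp_all add: convex_simplicial_cone closed_simplicial_cone assms(1))
  show "A *v pos_part x \<in> simplicial_cone A"
    by (simp add: simplicial_cone_def pos_part_in_nonneg_orthant)
  fix w assume "w \<in> simplicial_cone A"
  then obtain y where y: "y \<in> nonneg_orthant" and w: "w = A *v y"
    by (auto simp: simplicial_cone_def)
  have "(transpose A ** A) *v pos_part x - pos_part x + x = transpose A *v z"
    using eq by (simp only: matrix_vector_mult_diff_rdistrib matrix_vector_mul_lid)
  moreover have "transpose A *v (z - A *v pos_part x)
      = transpose A *v z - (transpose A ** A) *v pos_part x"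
    by (simp only: matrix_vector_mult_diff_distrib matrix_vector_mul_assoc)
  ultimately have "transpose A *v (z - A *v pos_part x) = x - pos_part x"
    by (metis add_diff_cancel_left' add_diff_eq diff_add_eq)
  \<comment> \<open>The row form \<open>v* A\<close> is the shape in which
    \<open>dot_lmul_matrix\<close> moves \<open>A\<close> across the inner product, reducing the
    angle condition on the cone to the one on the orthant.\<close>
  then have residual: "(z - A *v pos_part x) v* A = x - pos_part x"
    by (simp only: transpose_matrix_vector)
  have "(z - A *v pos_part x) \<bullet> (w - A *v pos_part x)
      = (z - A *v pos_part x) \<bullet> (A *v (y - pos_part x))"
    by (simp add: w matrix_vector_mult_diff_distrib)
  also have "\<dots> = (x - pos_part x) \<bullet> (y - pos_part x)"
    by (simp only: residual flip: dot_lmul_matrix)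
  also have "\<dots> \<le> 0"
    by (rule inner_diff_pos_part_le[OF y])
  finally show "(z - A *v pos_part x) \<bullet> (w - A *v pos_part x) \<le> 0" .
qed

theorem proposition1:
  fixes A :: "real ^ 'm ^ 'm" and z :: "real ^ 'm" and x :: "nat \<Rightarrow> real ^ 'm" and k :: nat
  assumes "invertible A"
    and "newton_sequence A z x"
    and "sgn_vec (pos_part (x (Suc k))) = sgn_vec (pos_part (x k))"
  shows "(transpose A ** A - mat 1) *v pos_part (x (Suc k)) + x (Suc k) = transpose A *v z
       \<and> closest_point (simplicial_cone A) z = A *v pos_part (x (Suc k))"
proof -
  let ?M = "transpose A ** A - mat 1"
  \<comment> \<open>The Newton step at \<open>k\<close> uses the signs of \<open>x k\<close>; the
    repeated pattern lets them be read off \<open>x (Suc k)\<close>, the vector being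
    multiplied.\<close>
  have "(?M ** diag (sgn_vec (pos_part (x (Suc k)))) + mat 1) *v x (Suc k) = transpose A *v z"
    using assms(2) unfolding newton_sequence_def assms(3) by blast
  then have "?M *v (diag (sgn_vec (pos_part (x (Suc k)))) *v x (Suc k)) + x (Suc k)
      = transpose A *v z"
    by (simp only: matrix_vector_mult_add_rdistrib matrix_vector_mul_assoc matrix_vector_mul_lid)
  then have "?M *v pos_part (x (Suc k)) + x (Suc k) = transpose A *v z"
    by (simp only: diag_sgn_pos_part)
  with closest_point_simplicial_cone[OF assms(1)] show ?thesis
    by blast
qed

end
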